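(* Let $n,k,q\ge1$ be integers such that $n>2^{13}k\log_2(2k)$ and $n\ge 4qk$. Let $\mathcal{F}\subset\binom{[n]}{k}$ be a regular intersecting family. Then $|\mathcal{F}|\le 2^{-q}\binom{n}{k}$.
   Context: $\binom{[n]}{k}$ is the family of $k$-element subsets of $[n]=\{1,\dots,n\}$. A family $\mathcal{F}$ is intersecting if $A\cap B\neq\emptyset$ for all $A,B\in\mathcal{F}$. A family $\mathcal{F}\subset\binom{[n]}{k}$ is regular if every element of $[n]$ is contained in the same number of sets of $\mathcal{F}$. *)

theory Defs
  imports Complex_Main "HOL-Library.Ramsey"
begin

definition intersecting_family :: "'a set set \<Rightarrow> bool" where
  "intersecting_family F \<longleftrightarrow> (\<forall>A\<in>F. \<forall>B\<in>F. A \<inter> B \<noteq> {})"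

(* Degrees are measured with card, so this is meaningful for finite F only. *)
definition regular_family :: "'a set \<Rightarrow> 'a set set \<Rightarrow> bool" where
  "regular_family V F \<longleftrightarrow> (\<forall>x\<in>V. \<forall>y\<in>V. card {A\<in>F. x \<in> A} = card {A\<in>F. y \<in> A})"

end

theory Submission
  imports Defs
begin

text \<open>
  Put \<open>R = n / (2k)\<close> and let \<open>A\<close> be a maximal set contained in at least an \<open>R ^ - card A\<close> fraction of
  the members of \<open>F\<close>. As a set of size \<open>a\<close> lies in at most \<open>(k/n) ^ a * (n choose k)\<close> sets of size
  \<open>k\<close>, the bound is immediate if \<open>A\<close> has more than \<open>q\<close> elements. Otherwise, by regularity, at most a
  quarter of \<open>F\<close> meets \<open>A\<close>; let \<open>F'\<close> be the rest and choose \<open>B\<close> for \<open>F'\<close> as \<open>A\<close> was chosen for \<open>F\<close>.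
  Again we are done if \<open>B\<close> has more than \<open>q\<close> elements. If not, at least half of the members of \<open>F\<close>
  containing \<open>A\<close> avoid \<open>B\<close>, and by maximality of \<open>A\<close> and \<open>B\<close> these members (with \<open>A\<close> removed) and the
  members of \<open>F'\<close> containing \<open>B\<close> (with \<open>B\<close> removed) form \<open>R/2\<close>-spread families. As \<open>R\<close> is a large
  multiple of \<open>log 2 (2k)\<close>, a uniformly random set contains a member of such a family with probability
  above \<open>1/2\<close>; applied to a random set and its complement this yields two disjoint members of \<open>F\<close>.

  The probability estimate is the spread lemma of Alweiss, Lovett, Wu and Zhang, proved here by the
  minimal fragment argument of Park and Pham.
\<close>

section \<open>Expectations over random subsets\<close>

text \<open>The expectation of \<open>g W\<close> when \<open>W\<close> takes each element of
  \<open>X\<close> independently with probability \<open>p\<close>, as a finite sum and so a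
  polynomial in \<open>p\<close>.\<close>

definition subset_expect :: "real \<Rightarrow> 'a set \<Rightarrow> ('a set \<Rightarrow> real) \<Rightarrow> real" where
  "subset_expect p X g = (\<Sum>W\<in>Pow X. p ^ card W * (1 - p) ^ card (X - W) * g W)"

lemma subset_expect_empty [simp]: "subset_expect p {} g = g {}"
  by (simp add: subset_expect_def)

lemma subset_expect_add:
  "subset_expect p X (\<lambda>W. g W + h W) = subset_expect p X g + subset_expect p X h"
  by (simp add: subset_expect_def sum.distrib algebra_simps)

lemma subset_expect_cmult:
  "subset_expect p X (\<lambda>W. c * g W) = c * subset_expect p X g"
  by (simp add: subset_expect_def sum_distrib_left algebra_simps)

lemma subset_expect_mono:
  assumes "0 \<le> p" "p \<le> 1" "\<And>W. W \<subseteq> X \<Longrightarrow> g W \<le> h W"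
  shows "subset_expect p X g \<le> subset_expect p X h"
  unfolding subset_expect_def using assms by (intro sum_mono mult_left_mono) auto

text \<open>Condition on whether \<open>x\<close> is selected. This is the recursion behind the
  inductions on \<open>X\<close> below.\<close>

lemma subset_expect_insert:
  assumes "finite X" "x \<notin> X"
  shows "subset_expect p (insert x X) g =
    p * subset_expect p X (\<lambda>W. g (insert x W)) + (1 - p) * subset_expect p X g"
proof -
  let ?w = "\<lambda>W. p ^ card W * (1 - p) ^ card (insert x X - W) * g W"
  have inj: "inj_on (insert x) (Pow X)"
    using assms(2) by (auto simp: inj_on_def)
  have "(\<Sum>W\<in>insert x ` Pow X. ?w W) = (\<Sum>W\<in>Pow X. ?w (insert x W))"
    by (simp add: sum.reindex[OF inj])
  also have "\<dots> = (\<Sum>W\<in>Pow X. p * (p ^ card W * (1 - p) ^ card (X - W) * g (insert x W)))"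
  proof (rule sum.cong[OF refl])
    fix W assume W: "W \<in> Pow X"
    then have "finite W" "x \<notin> W" "insert x X - insert x W = X - W"
      using assms finite_subset by auto
    then show "?w (insert x W) = p * (p ^ card W * (1 - p) ^ card (X - W) * g (insert x W))"
      by simp
  qed
  finally have 1: "(\<Sum>W\<in>insert x ` Pow X. ?w W) = p * subset_expect p X (\<lambda>W. g (insert x W))"
    by (simp add: subset_expect_def sum_distrib_left)
  have "(\<Sum>W\<in>Pow X. ?w W) = (\<Sum>W\<in>Pow X. (1 - p) * (p ^ card W * (1 - p) ^ card (X - W) * g W))"
  proof (rule sum.cong[OF refl])
    fix W assume W: "W \<in> Pow X"
    then have "insert x X - W = insert x (X - W)" using assms by auto
    then have "card (insert x X - W) = Suc (card (X - W))" using assms by simp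
    then show "?w W = (1 - p) * (p ^ card W * (1 - p) ^ card (X - W) * g W)" by simp
  qed
  then have 2: "(\<Sum>W\<in>Pow X. ?w W) = (1 - p) * subset_expect p X g"
    by (simp add: subset_expect_def sum_distrib_left)
  have "subset_expect p (insert x X) g = (\<Sum>W\<in>Pow X. ?w W) + (\<Sum>W\<in>insert x ` Pow X. ?w W)"
    unfolding subset_expect_def Pow_insert
    by (rule sum.union_disjoint) (use assms in auto)
  then show ?thesis using 1 2 by simp
qed

lemma subset_expect_const:
  assumes "finite X"
  shows "subset_expect p X (\<lambda>_. c) = c"
  using assms by induction (auto simp: subset_expect_insert algebra_simps)

text \<open>An element misses two independent random sets with probability
  \<open>(1 - p) * (1 - r)\<close>. The function \<open>g\<close> varies in the induction, since
  selecting \<open>x\<close> leads to \<open>g (insert x W)\<close>.\<close>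

lemma subset_expect_union:
  assumes "finite X"
  shows "subset_expect p X (\<lambda>V. subset_expect r X (\<lambda>W. g (V \<union> W))) =
    subset_expect (p + r - p * r) X g"
  using assms
proof (induction X arbitrary: g)
  case (insert x X)
  show ?case
    using insert.IH[of g] insert.IH[of "\<lambda>W. g (insert x W)"] insert.hyps
    by (simp add: subset_expect_insert subset_expect_add subset_expect_cmult)
      (simp add: algebra_simps)
qed simp

text \<open>At density 1/2 all subsets have the same weight, so complementation preserves the
  distribution.\<close>

lemma subset_expect_half_complement:
  assumes "finite X"
  shows "subset_expect (1/2) X (\<lambda>W. g (X - W)) = subset_expect (1/2) X g"
proof -
  have "bij_betw (\<lambda>W. X - W) (Pow X) (Pow X)"
    by (rule bij_betwI[where g = "\<lambda>W. X - W"]) auto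
  from sum.reindex_bij_betw[OF this, of "\<lambda>W. (1/2) ^ card W * (1 - 1/2) ^ card (X - W) * g W"]
  show ?thesis
    unfolding subset_expect_def
    by (auto simp: double_diff mult.commute intro!: sum.cong)
qed

section \<open>The spread lemma\<close>

text \<open>A minimal fragment \<open>T\<close> of a set relative to \<open>W\<close> lies in every member of the family that is
  contained in \<open>W \<union> T\<close>. So \<open>T\<close> is one of at most \<open>2 ^ l\<close> subsets of a set depending only on
  \<open>W \<union> T\<close>, and replacing \<open>W\<close> by \<open>W \<union> T\<close> costs a factor of at most \<open>p\<close> to the power \<open>- card T\<close>.\<close>
lemma minimal_fragment_expectation:
  fixes f :: "'b \<Rightarrow> 'a set" and chi :: "'a set \<Rightarrow> 'b \<Rightarrow> 'a set"
  assumes fin: "finite X" "finite I"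
    and fX: "\<And>i. i \<in> I \<Longrightarrow> f i \<subseteq> X" and fl: "\<And>i. i \<in> I \<Longrightarrow> card (f i) \<le> l"
    and p: "0 < p" "p < 1" and kappa: "0 < \<kappa>" "1 \<le> p * \<kappa>"
    and spread: "\<And>T. T \<subseteq> X \<Longrightarrow> real (card {i\<in>I. T \<subseteq> f i}) \<le> M / \<kappa> ^ card T"
    and chi_ex: "\<And>W i. i \<in> I \<Longrightarrow> \<exists>j\<in>I. f j \<subseteq> W \<union> f i \<and> chi W i = f j - W"
    and chi_min: "\<And>W i j. i \<in> I \<Longrightarrow> j \<in> I \<Longrightarrow> f j \<subseteq> W \<union> f i \<Longrightarrow> card (chi W i) \<le> card (f j - W)"
  shows "subset_expect p X (\<lambda>W. real (card {i\<in>I. s \<le> card (chi W i)})) \<le> M * 2 ^ l / (p * \<kappa>) ^ s"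
proof -
  have M0: "0 \<le> M" using spread[of "{}"] by (smt (verit) card.empty div_by_1 empty_subsetI of_nat_0_le_iff power_0)
  define mu where "mu W = p ^ card W * (1 - p) ^ card (X - W)" for W
  have mu0: "0 \<le> mu W" for W using p by (simp add: mu_def)
  define \<T> where "\<T> W = {T. \<exists>i\<in>I. T = chi W i \<and> s \<le> card T}" for W
  \<comment> \<open>\<open>C Z\<close> is one member inside \<open>Z\<close>, chosen from
    \<open>Z\<close> alone. If there is none it is a junk value, and the last condition in
    \<open>Q\<close> then makes \<open>Q Z\<close> empty.\<close>
  define C where "C Z = f (SOME j. j \<in> I \<and> f j \<subseteq> Z)" for Z
  define Q where "Q Z = {T. T \<subseteq> C Z \<and> s \<le> card T \<and> (\<exists>j\<in>I. f j \<subseteq> Z)}" for Z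
  have C: "C Z \<subseteq> Z \<and> C Z \<subseteq> X \<and> card (C Z) \<le> l \<and> (\<exists>j\<in>I. C Z = f j)" if "\<exists>j\<in>I. f j \<subseteq> Z" for Z
  proof -
    from that have "\<exists>j. j \<in> I \<and> f j \<subseteq> Z" by blast
    from someI_ex[OF this] show ?thesis using fX fl unfolding C_def by blast
  qed
  have chi_sub: "chi W i \<subseteq> f i \<and> chi W i \<inter> W = {}" if "i \<in> I" for W i
    using chi_ex[OF that, of W] by auto
  have finT: "finite (\<T> W)" for W
  proof -
    have "\<T> W \<subseteq> chi W ` I" by (auto simp: \<T>_def)
    then show ?thesis using fin(2) finite_surj by blast
  qed
  have TX: "T \<subseteq> X \<and> T \<inter> W = {}" if "T \<in> \<T> W" for T W
    using that chi_sub fX unfolding \<T>_def by blast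
  have key: "T \<subseteq> C (W \<union> T) \<and> (\<exists>j\<in>I. f j \<subseteq> W \<union> T)" if T: "T \<in> \<T> W" for T W
  proof -
    from T obtain i where i: "i \<in> I" "T = chi W i" by (auto simp: \<T>_def)
    from chi_ex[OF i(1), of W] i obtain j where j: "j \<in> I" "f j \<subseteq> W \<union> f i" "T = f j - W" by auto
    then have ex: "\<exists>j\<in>I. f j \<subseteq> W \<union> T" by auto
    from C[OF this] obtain j' where j': "j' \<in> I" "C (W \<union> T) = f j'" "f j' \<subseteq> W \<union> T" by auto
    \<comment> \<open>The member \<open>f j'\<close> chosen for \<open>W \<union> T\<close> competes
      with \<open>T\<close> in the minimality for \<open>i\<close>, so its part outside
      \<open>W\<close>, a subset of \<open>T\<close>, must be all of \<open>T\<close>.\<close>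
    have "f j' \<subseteq> W \<union> f i" using j'(3) i chi_sub by blast
    from chi_min[OF i(1) j'(1) this] i have le: "card T \<le> card (f j' - W)" by simp
    have "finite T" using TX[OF T] fin finite_subset by blast
    moreover have "f j' - W \<subseteq> T" using j' by auto
    ultimately have "f j' - W = T" using le card_seteq by blast
    then show ?thesis using j' ex by auto
  qed
  \<comment> \<open>Group the indices by their fragment \<open>T\<close>; since \<open>T\<close> is
    contained in \<open>f i\<close>, spreadness bounds each group.\<close>
  have bound1: "real (card {i\<in>I. s \<le> card (chi W i)}) \<le> (\<Sum>T\<in>\<T> W. M / \<kappa> ^ card T)" for W
  proof -
    have "{i\<in>I. s \<le> card (chi W i)} \<subseteq> (\<Union>T\<in>\<T> W. {i\<in>I. T \<subseteq> f i})"
      using chi_sub by (fastforce simp: \<T>_def)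
    then have "card {i\<in>I. s \<le> card (chi W i)} \<le> card (\<Union>T\<in>\<T> W. {i\<in>I. T \<subseteq> f i})"
      by (intro card_mono) (use fin finT in auto)
    also have "\<dots> \<le> (\<Sum>T\<in>\<T> W. card {i\<in>I. T \<subseteq> f i})"
      by (rule card_UN_le[OF finT])
    finally have "real (card {i\<in>I. s \<le> card (chi W i)}) \<le> real (\<Sum>T\<in>\<T> W. card {i\<in>I. T \<subseteq> f i})"
      by (rule of_nat_mono)
    also have "\<dots> = (\<Sum>T\<in>\<T> W. real (card {i\<in>I. T \<subseteq> f i}))" by (rule of_nat_sum)
    also have "\<dots> \<le> (\<Sum>T\<in>\<T> W. M / \<kappa> ^ card T)"
      by (intro sum_mono spread) (use TX in auto)
    finally show ?thesis .
  qed
  have finQ: "finite (Q Z)" and cardQ: "card (Q Z) \<le> 2 ^ l" for Z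
  proof -
    have "finite (Q Z) \<and> card (Q Z) \<le> 2 ^ l"
    proof (cases "\<exists>j\<in>I. f j \<subseteq> Z")
      case True
      from C[OF True] have fC: "finite (C Z)" "card (C Z) \<le> l" using fin finite_subset by auto
      have sub: "Q Z \<subseteq> Pow (C Z)" by (auto simp: Q_def)
      have "card (Q Z) \<le> 2 ^ card (C Z)" using card_mono[OF _ sub] fC by (simp add: card_Pow)
      also have "(2::nat) ^ card (C Z) \<le> 2 ^ l" using fC by (intro power_increasing) auto
      finally show ?thesis using sub fC finite_subset by blast
    next
      case False
      then have "Q Z = {}" by (auto simp: Q_def)
      then show ?thesis by simp
    qed
    then show "finite (Q Z)" "card (Q Z) \<le> 2 ^ l" by auto
  qed
  \<comment> \<open>Encoding \<open>(W, T)\<close> by \<open>(W \<union> T, T)\<close> loses nothing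
    because \<open>T\<close> is disjoint from \<open>W\<close>, and each union admits at most
    \<open>2 ^ l\<close> second components.\<close>
  let ?h = "\<lambda>(W, T). (W \<union> T, T)"
  let ?S = "SIGMA W:Pow X. \<T> W" and ?S' = "SIGMA Z:Pow X. Q Z"
  let ?v = "\<lambda>(Z, T). mu Z * (M / (p * \<kappa>) ^ s)"
  have "W = W'" if "T \<in> \<T> W" "T \<in> \<T> W'" "W \<union> T = W' \<union> T" for W W' T
    using TX[OF that(1)] TX[OF that(2)] that(3) by blast
  then have inj: "inj_on ?h ?S" by (intro inj_onI) auto
  have im: "?h ` ?S \<subseteq> ?S'"
  proof -
    have "W \<union> T \<subseteq> X" "T \<in> Q (W \<union> T)" if "W \<subseteq> X" "T \<in> \<T> W" for W T
      using that TX[of T W] key[of T W] by (auto simp: Q_def \<T>_def)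
    then show ?thesis by auto
  qed
  \<comment> \<open>Adding \<open>T\<close> to \<open>W\<close> multiplies the weight by
    \<open>(p / (1 - p)) ^ card T\<close>, which is at least \<open>p ^ card T\<close>. The
    resulting denominator \<open>(p * \<kappa>) ^ card T\<close> is at least
    \<open>(p * \<kappa>) ^ s\<close>.\<close>
  have weight: "mu W * (M / \<kappa> ^ card T) \<le> mu (W \<union> T) * (M / (p * \<kappa>) ^ s)"
    if W: "W \<subseteq> X" and T: "T \<in> \<T> W" for W T
  proof -
    have fW: "finite W" "finite T" using W TX[OF T] fin finite_subset by auto
    have s: "s \<le> card T" using T by (auto simp: \<T>_def)
    have c1: "card (W \<union> T) = card W + card T" using fW TX[OF T] by (simp add: card_Un_disjoint Int_commute)
    have "X - W = (X - (W \<union> T)) \<union> T" using TX[OF T] by auto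
    moreover have "card ((X - (W \<union> T)) \<union> T) = card (X - (W \<union> T)) + card T"
      by (rule card_Un_disjoint) (use fin fW in auto)
    ultimately have c2: "card (X - W) = card (X - (W \<union> T)) + card T" by simp
    have e: "mu W * p ^ card T = mu (W \<union> T) * (1 - p) ^ card T"
      unfolding mu_def c1 c2 by (simp add: power_add)
    have "mu (W \<union> T) * (1 - p) ^ card T \<le> mu (W \<union> T) * 1"
      using p mu0 by (intro mult_left_mono power_le_one) auto
    with e have "mu W * p ^ card T \<le> mu (W \<union> T)" by simp
    then have "mu W \<le> mu (W \<union> T) / p ^ card T" using p by (simp add: pos_le_divide_eq)
    then have "mu W * (M / \<kappa> ^ card T) \<le> mu (W \<union> T) / p ^ card T * (M / \<kappa> ^ card T)"
      using M0 kappa by (intro mult_right_mono) auto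
    also have "\<dots> = mu (W \<union> T) * (M / (p * \<kappa>) ^ card T)" by (simp add: power_mult_distrib)
    also have "\<dots> \<le> mu (W \<union> T) * (M / (p * \<kappa>) ^ s)"
      using mu0 M0 kappa s by (intro mult_left_mono divide_left_mono power_increasing) auto
    finally show ?thesis .
  qed
  have "subset_expect p X (\<lambda>W. real (card {i\<in>I. s \<le> card (chi W i)}))
      \<le> subset_expect p X (\<lambda>W. \<Sum>T\<in>\<T> W. M / \<kappa> ^ card T)"
    by (intro subset_expect_mono bound1) (use p in auto)
  also have "\<dots> = (\<Sum>W\<in>Pow X. \<Sum>T\<in>\<T> W. mu W * (M / \<kappa> ^ card T))"
    by (simp add: subset_expect_def mu_def sum_distrib_left)
  also have "\<dots> \<le> (\<Sum>W\<in>Pow X. \<Sum>T\<in>\<T> W. mu (W \<union> T) * (M / (p * \<kappa>) ^ s))"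
    by (intro sum_mono weight) auto
  also have "\<dots> = (\<Sum>x\<in>?S. ?v (?h x))"
    using fin finT by (subst sum.Sigma) (auto intro!: sum.cong)
  also have "\<dots> = (\<Sum>x\<in>?h ` ?S. ?v x)"
    by (simp only: sum.reindex[OF inj] comp_def)
  also have "\<dots> \<le> (\<Sum>x\<in>?S'. ?v x)"
    using im fin finQ mu0 M0 kappa p by (intro sum_mono2) auto
  also have "\<dots> = (\<Sum>Z\<in>Pow X. \<Sum>T\<in>Q Z. mu Z * (M / (p * \<kappa>) ^ s))"
    using fin finQ by (subst sum.Sigma) auto
  also have "\<dots> = (\<Sum>Z\<in>Pow X. mu Z * (real (card (Q Z)) * (M / (p * \<kappa>) ^ s)))"
    by (simp add: mult_ac)
  also have "\<dots> \<le> (\<Sum>Z\<in>Pow X. mu Z * (2 ^ l * (M / (p * \<kappa>) ^ s)))"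
  proof (intro sum_mono mult_left_mono mult_right_mono)
    show "real (card (Q Z)) \<le> 2 ^ l" for Z using cardQ[of Z]
      by (metis of_nat_le_iff of_nat_numeral of_nat_power)
  qed (use mu0 M0 kappa p in auto)
  also have "\<dots> = subset_expect p X (\<lambda>_. 2 ^ l * (M / (p * \<kappa>) ^ s))"
    by (simp add: subset_expect_def mu_def)
  also have "\<dots> = M * 2 ^ l / (p * \<kappa>) ^ s" using fin by (simp add: subset_expect_const)
  finally show ?thesis .
qed

text \<open>Exposing the random set in \<open>m\<close> independent rounds of density \<open>p\<close>, each round halves the
  bound on the fragment sizes, up to discarding few indices. The bound \<open>M\<close> is absolute, so spreadness
  passes to fragments and to subfamilies for free.\<close>
lemma spread_avoid_expectation:
  fixes f :: "'b \<Rightarrow> 'a set"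
  assumes "finite X" and p: "0 < p" "p < 1" and kappa: "8 \<le> p * \<kappa>"
    and "finite I" "\<And>i. i \<in> I \<Longrightarrow> f i \<subseteq> X" "\<And>i. i \<in> I \<Longrightarrow> card (f i) < 2 ^ m"
    and "\<And>T. T \<subseteq> X \<Longrightarrow> real (card {i\<in>I. T \<subseteq> f i}) \<le> M / \<kappa> ^ card T"
  shows "real (card I) * subset_expect (1 - (1 - p) ^ m) X (\<lambda>W. of_bool (\<forall>i\<in>I. \<not> f i \<subseteq> W))
    \<le> M * ((1 - 1 / 2 ^ m) / 2)"
  using assms(5-)
proof (induction m arbitrary: f I)
  case 0
  show ?case
  proof (cases "I = {}")
    case False
    then obtain i where "i \<in> I" by auto
    \<comment> \<open>Size below \<open>2 ^ 0\<close> means empty, so every \<open>W\<close>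
      contains a member and the event of avoiding all of them is impossible.\<close>
    moreover have "f i = {}" if "i \<in> I" for i
      using 0(2,3)[OF that] finite_subset[OF _ \<open>finite X\<close>] by auto
    ultimately have "(\<lambda>W. of_bool (\<forall>i\<in>I. \<not> f i \<subseteq> W)) = (\<lambda>W. 0 :: real)" by (intro ext) auto
    then show ?thesis using \<open>finite X\<close> by (simp add: subset_expect_const)
  qed simp
next
  case (Suc m)
  have k0: "0 < \<kappa>" using kappa p by (smt (verit) mult_nonneg_nonpos)
  have M0: "0 \<le> M" using Suc.prems(4)[of "{}"]
    by (smt (verit) card.empty div_by_1 empty_subsetI of_nat_0_le_iff power_0)
  define r where "r = 1 - (1 - p) ^ m"
  have r01: "0 \<le> r" "r \<le> 1" using p by (auto simp: r_def power_le_one)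
  \<comment> \<open>The first round has density \<open>p\<close>; the union of the remaining
    \<open>m\<close> rounds has density \<open>r\<close>.\<close>
  have pr: "1 - (1 - p) ^ Suc m = p + r - p * r" by (simp add: r_def algebra_simps)
  define is_min where "is_min W i T \<longleftrightarrow> (\<exists>j\<in>I. f j \<subseteq> W \<union> f i \<and> T = f j - W) \<and>
      (\<forall>j\<in>I. f j \<subseteq> W \<union> f i \<longrightarrow> card T \<le> card (f j - W))" for W i T
  have ex_min: "\<exists>T. is_min W i T" if "i \<in> I" for W i
  proof -
    obtain j where "j \<in> I \<and> f j \<subseteq> W \<union> f i"
      "\<forall>j'. j' \<in> I \<and> f j' \<subseteq> W \<union> f i \<longrightarrow> card (f j - W) \<le> card (f j' - W)"
      using ex_has_least_nat[of "\<lambda>j. j \<in> I \<and> f j \<subseteq> W \<union> f i" i "\<lambda>j. card (f j - W)"] \<open>i \<in> I\<close>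
      by blast
    then show ?thesis unfolding is_min_def by blast
  qed
  define chi where "chi W i = (SOME T. is_min W i T)" for W i
  have chi: "is_min W i (chi W i)" if "i \<in> I" for W i
    unfolding chi_def by (rule someI_ex[OF ex_min[OF that]])
  have chi_ex: "\<exists>j\<in>I. f j \<subseteq> W \<union> f i \<and> chi W i = f j - W" if "i \<in> I" for W i
    using chi[OF that, of W] unfolding is_min_def by blast
  have chi_min: "card (chi W i) \<le> card (f j - W)" if "i \<in> I" "j \<in> I" "f j \<subseteq> W \<union> f i" for W i j
    using chi[OF that(1), of W] that(2,3) unfolding is_min_def by blast
  define bad where "bad W = {i\<in>I. 2 ^ m \<le> card (chi W i)}" for W
  have "subset_expect p X (\<lambda>W. real (card (bad W))) \<le> M * 2 ^ (2 ^ Suc m - 1) / (p * \<kappa>) ^ (2 ^ m)"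
    unfolding bad_def
  proof (rule minimal_fragment_expectation[where f = f])
    show "card (f i) \<le> 2 ^ Suc m - 1" if "i \<in> I" for i using Suc.prems(3)[OF that] by simp
  qed (use assms k0 Suc.prems chi_ex chi_min in auto)
  \<comment> \<open>This loss is exactly the growth of \<open>M * ((1 - 1 / 2 ^ m) / 2)\<close> when
    \<open>m\<close> becomes \<open>Suc m\<close>. It is affordable because
    \<open>p * \<kappa>\<close> is at least \<open>2 ^ 3\<close> and
    \<open>m + 1 \<le> 2 ^ m\<close>.\<close>
  also have "\<dots> \<le> M * (1 / 2 ^ (m + 2))"
  proof -
    have "(2::nat) ^ Suc m - 1 + (m + 2) \<le> 3 * 2 ^ m"
      using less_exp[of m] Suc_leI[of m "2 ^ m"] by simp
    then have "(2::real) ^ (2 ^ Suc m - 1 + (m + 2)) \<le> 2 ^ (3 * 2 ^ m)"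
      by (intro power_increasing) auto
    also have "\<dots> = 8 ^ (2 ^ m)" by (simp add: power_mult)
    also have "\<dots> \<le> (p * \<kappa>) ^ (2 ^ m)" using kappa by (intro power_mono) auto
    finally have "2 ^ (2 ^ Suc m - 1) * 2 ^ (m + 2) \<le> (p * \<kappa>) ^ (2 ^ m)"
      by (simp only: power_add)
    then have "2 ^ (2 ^ Suc m - 1) / (p * \<kappa>) ^ (2 ^ m) \<le> 1 / 2 ^ (m + 2)"
      using p k0 by (simp add: field_simps)
    from mult_left_mono[OF this M0] show ?thesis by simp
  qed
  finally have bad: "subset_expect p X (\<lambda>W. real (card (bad W))) \<le> M * (1 / 2 ^ (m + 2))" .
  \<comment> \<open>For fixed \<open>W\<close>, the induction hypothesis is applied to the fragments
    of the indices that are not bad: a fragment covered by \<open>V\<close> puts some original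
    member into \<open>W \<union> V\<close>. Bad indices are charged with probability at most 1.
    Families are indexed because different indices may share a fragment.\<close>
  have step: "real (card I) * subset_expect r X (\<lambda>V. of_bool (\<forall>i\<in>I. \<not> f i \<subseteq> W \<union> V))
      \<le> M * ((1 - 1 / 2 ^ m) / 2) + real (card (bad W))" if W: "W \<subseteq> X" for W
  proof -
    define J where "J = I - bad W"
    let ?E = "subset_expect r X (\<lambda>V. of_bool (\<forall>i\<in>I. \<not> f i \<subseteq> W \<union> V))"
    let ?E' = "subset_expect r X (\<lambda>V. of_bool (\<forall>i\<in>J. \<not> chi W i \<subseteq> V))"
    have sub: "chi W i \<subseteq> f i" if "i \<in> I" for i using chi_ex[OF that, of W] by auto
    have "real (card J) * ?E' \<le> M * ((1 - 1 / 2 ^ m) / 2)"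
      unfolding r_def
    proof (rule Suc.IH)
      show "finite J" using Suc.prems by (simp add: J_def)
      show "chi W i \<subseteq> X" if "i \<in> J" for i using that sub Suc.prems(2) by (auto simp: J_def)
      show "card (chi W i) < 2 ^ m" if "i \<in> J" for i using that by (auto simp: J_def bad_def)
      show "real (card {i\<in>J. T \<subseteq> chi W i}) \<le> M / \<kappa> ^ card T" if "T \<subseteq> X" for T
      proof -
        have "card {i\<in>J. T \<subseteq> chi W i} \<le> card {i\<in>I. T \<subseteq> f i}"
          using Suc.prems(1) sub by (intro card_mono) (auto simp: J_def)
        then show ?thesis using Suc.prems(4)[OF that] by linarith
      qed
    qed
    moreover have "?E \<le> ?E'"
    proof (intro subset_expect_mono r01)
      fix V
      have "\<exists>j\<in>I. f j \<subseteq> W \<union> V" if "i \<in> J" "chi W i \<subseteq> V" for i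
        using chi_ex[of i W] that by (auto simp: J_def)
      then show "(of_bool (\<forall>i\<in>I. \<not> f i \<subseteq> W \<union> V) :: real) \<le> of_bool (\<forall>i\<in>J. \<not> chi W i \<subseteq> V)"
        by auto
    qed
    moreover have "?E \<le> 1"
    proof -
      have "?E \<le> subset_expect r X (\<lambda>_. 1)" by (intro subset_expect_mono r01) auto
      then show ?thesis using \<open>finite X\<close> by (simp add: subset_expect_const)
    qed
    moreover have "real (card I) = real (card J) + real (card (bad W))"
    proof -
      have "bad W \<subseteq> I" by (auto simp: bad_def)
      then show ?thesis using Suc.prems(1) unfolding J_def
        by (simp add: card_Diff_subset finite_subset card_mono of_nat_diff)
    qed
    ultimately show ?thesis
      by (smt (verit) distrib_right mult_left_mono mult_left_le of_nat_0_le_iff)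
  qed
  have "real (card I) * subset_expect (1 - (1 - p) ^ Suc m) X (\<lambda>W. of_bool (\<forall>i\<in>I. \<not> f i \<subseteq> W))
      = subset_expect p X (\<lambda>W. real (card I) * subset_expect r X (\<lambda>V. of_bool (\<forall>i\<in>I. \<not> f i \<subseteq> W \<union> V)))"
    unfolding pr subset_expect_cmult
    using subset_expect_union[OF \<open>finite X\<close>, of p r "\<lambda>W. of_bool (\<forall>i\<in>I. \<not> f i \<subseteq> W)"] by simp
  also have "\<dots> \<le> subset_expect p X (\<lambda>W. M * ((1 - 1 / 2 ^ m) / 2) + real (card (bad W)))"
    by (intro subset_expect_mono step) (use p in auto)
  also have "\<dots> \<le> M * ((1 - 1 / 2 ^ m) / 2) + M * (1 / 2 ^ (m + 2))"
    using bad \<open>finite X\<close> by (simp add: subset_expect_add subset_expect_const)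
  also have "\<dots> = M * ((1 - 1 / 2 ^ Suc m) / 2)" by (simp add: field_simps)
  finally show ?case .
qed

text \<open>Take \<open>m\<close> rounds with \<open>(1 - p) ^ m = 1/2\<close>, so that their union
  is a uniformly random set, and \<open>M = card I\<close>. The term \<open>1 / 2 ^ m\<close> keeps
  the bound strictly below 1/2, so that two failure probabilities add up to less than 1.\<close>

lemma spread_avoid_half:
  fixes f :: "'b \<Rightarrow> 'a set"
  assumes "finite X" and I: "finite I" "I \<noteq> {}" and m: "1 \<le> m" and kappa: "16 * real m \<le> \<kappa>"
    and "\<And>i. i \<in> I \<Longrightarrow> f i \<subseteq> X" "\<And>i. i \<in> I \<Longrightarrow> card (f i) < 2 ^ m"
    and "\<And>T. T \<subseteq> X \<Longrightarrow> real (card {i\<in>I. T \<subseteq> f i}) \<le> real (card I) / \<kappa> ^ card T"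
  shows "subset_expect (1/2) X (\<lambda>W. of_bool (\<forall>i\<in>I. \<not> f i \<subseteq> W)) < 1/2"
proof -
  define p where "p = 1 - (1/2) powr (1 / real m)"
  have p1: "p < 1" by (simp add: p_def)
  have pm: "(1 - p) ^ m = 1/2"
    using m by (simp add: p_def flip: powr_realpow) (simp add: powr_powr)
  \<comment> \<open>Bernoulli's inequality leads to \<open>p \<ge> 1 / (2 * m)\<close>, which turns
    \<open>16 * m \<le> \<kappa>\<close> into the required
    \<open>8 \<le> p * \<kappa>\<close>.\<close>
  have "1/2 \<le> (1 - 1 / (2 * real m)) ^ m"
    using Bernoulli_inequality[of "- 1 / (2 * real m)" m] m by (simp add: field_simps)
  then have "(1 - p) ^ m \<le> (1 - 1 / (2 * real m)) ^ m" by (simp add: pm)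
  then have "1 - p \<le> 1 - 1 / (2 * real m)"
    using m by (subst (asm) power_mono_iff) (use p1 in \<open>auto simp: field_simps\<close>)
  then have p: "1 / (2 * real m) \<le> p" by simp
  have p0: "0 < p" by (rule less_le_trans[OF _ p]) (use m in auto)
  have "8 = 1 / (2 * real m) * (16 * real m)" using m by simp
  also have "\<dots> \<le> p * \<kappa>" using p p0 kappa m by (intro mult_mono) auto
  finally have "8 \<le> p * \<kappa>" .
  from spread_avoid_expectation[OF assms(1) p0 p1 this I(1) assms(6,7,8)]
  have "real (card I) * subset_expect (1/2) X (\<lambda>W. of_bool (\<forall>i\<in>I. \<not> f i \<subseteq> W))
      \<le> real (card I) * ((1 - 1 / 2 ^ m) / 2)" by (simp add: pm)
  moreover have "0 < real (card I)" using I by (simp add: card_gt_0_iff)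
  ultimately have "subset_expect (1/2) X (\<lambda>W. of_bool (\<forall>i\<in>I. \<not> f i \<subseteq> W)) \<le> (1 - 1 / 2 ^ m) / 2"
    by (simp only: mult_le_cancel_left_pos)
  also have "\<dots> < 1/2" by simp
  finally show ?thesis .
qed

text \<open>A uniformly random \<open>W\<close> and its complement each fail to contain a member of
  their family with probability below 1/2, so for some \<open>W\<close> both succeed.\<close>

lemma spread_families_disjoint_members:
  fixes f :: "'b \<Rightarrow> 'a set" and g :: "'c \<Rightarrow> 'a set"
  assumes "finite X" and m: "1 \<le> m" "16 * real m \<le> \<kappa>"
    and I: "finite I" "I \<noteq> {}" "\<And>i. i \<in> I \<Longrightarrow> f i \<subseteq> X" "\<And>i. i \<in> I \<Longrightarrow> card (f i) < 2 ^ m"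
      "\<And>T. T \<subseteq> X \<Longrightarrow> real (card {i\<in>I. T \<subseteq> f i}) \<le> real (card I) / \<kappa> ^ card T"
    and J: "finite J" "J \<noteq> {}" "\<And>j. j \<in> J \<Longrightarrow> g j \<subseteq> X" "\<And>j. j \<in> J \<Longrightarrow> card (g j) < 2 ^ m"
      "\<And>T. T \<subseteq> X \<Longrightarrow> real (card {j\<in>J. T \<subseteq> g j}) \<le> real (card J) / \<kappa> ^ card T"
  shows "\<exists>i\<in>I. \<exists>j\<in>J. f i \<inter> g j = {}"
proof (rule ccontr)
  assume neg: "\<not> ?thesis"
  let ?a = "\<lambda>W. of_bool (\<forall>i\<in>I. \<not> f i \<subseteq> W) :: real"
  let ?b = "\<lambda>W. of_bool (\<forall>j\<in>J. \<not> g j \<subseteq> W) :: real"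
  have "1 = subset_expect (1/2) X (\<lambda>_. 1)" using assms(1) by (simp add: subset_expect_const)
  also have "\<dots> \<le> subset_expect (1/2) X (\<lambda>W. ?a W + ?b (X - W))"
  proof (rule subset_expect_mono)
    fix W
    have "(\<forall>i\<in>I. \<not> f i \<subseteq> W) \<or> (\<forall>j\<in>J. \<not> g j \<subseteq> X - W)" using neg by blast
    then show "1 \<le> ?a W + ?b (X - W)" by auto
  qed auto
  also have "\<dots> = subset_expect (1/2) X ?a + subset_expect (1/2) X ?b"
    by (simp only: subset_expect_add subset_expect_half_complement[OF assms(1), of ?b])
  also have "\<dots> < 1/2 + 1/2"
    by (intro add_strict_mono spread_avoid_half[where \<kappa> = \<kappa> and m = m]) (use assms in auto)
  finally show False by simp
qed

section \<open>Maximal heavy sets\<close>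

text \<open>The empty set satisfies the second conclusion, and every set satisfying it lies in a
  member of \<open>H\<close>, so one of largest size exists. For nonempty \<open>T\<close> disjoint
  from \<open>A\<close> the set \<open>A \<union> T\<close> violates it; comparing the two
  inequalities gives the spread bound.\<close>

lemma maximal_heavy_set:
  fixes H :: "'a set set" and R :: real
  assumes H: "finite H" "H \<noteq> {}" "\<And>S. S \<in> H \<Longrightarrow> finite S" and R: "0 < R"
  obtains A where "{S\<in>H. A \<subseteq> S} \<noteq> {}" "real (card H) \<le> real (card {S\<in>H. A \<subseteq> S}) * R ^ card A"
    "\<And>T. finite T \<Longrightarrow> T \<inter> A = {} \<Longrightarrow>
      real (card {S\<in>H. A \<union> T \<subseteq> S}) \<le> real (card {S\<in>H. A \<subseteq> S}) / R ^ card T"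
proof -
  define P where "P A \<longleftrightarrow> real (card H) \<le> real (card {S\<in>H. A \<subseteq> S}) * R ^ card A" for A
  have cH: "0 < card H" using H by (simp add: card_gt_0_iff)
  have ne: "{S\<in>H. A \<subseteq> S} \<noteq> {}" if "P A" for A
  proof
    assume "{S\<in>H. A \<subseteq> S} = {}"
    with that cH show False by (simp add: P_def)
  qed
  have "finite (\<Union>H)" using H by auto
  have sub: "A \<subseteq> \<Union>H" if "P A" for A using ne[OF that] by auto
  have "P {}" by (simp add: P_def)
  moreover have "\<forall>A. P A \<longrightarrow> card A < Suc (card (\<Union>H))"
    using sub \<open>finite (\<Union>H)\<close> by (auto simp: less_Suc_eq_le intro: card_mono)
  ultimately obtain A where A: "P A" "\<forall>B. P B \<longrightarrow> card B \<le> card A"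
    using ex_has_greatest_nat[of P "{}" card "Suc (card (\<Union>H))"] by auto
  have finA: "finite A" using sub[OF A(1)] \<open>finite (\<Union>H)\<close> finite_subset by blast
  have "real (card {S\<in>H. A \<union> T \<subseteq> S}) \<le> real (card {S\<in>H. A \<subseteq> S}) / R ^ card T"
    if T: "finite T" "T \<inter> A = {}" for T
  proof (cases "T = {}")
    case False
    have c: "card (A \<union> T) = card A + card T" using T finA by (simp add: card_Un_disjoint Int_commute)
    moreover have "0 < card T" using T False by (simp add: card_gt_0_iff)
    ultimately have "\<not> P (A \<union> T)" using A(2) by fastforce
    then have "real (card {S\<in>H. A \<union> T \<subseteq> S}) * R ^ (card A + card T) < real (card H)"
      by (simp add: P_def c not_le)
    also have "\<dots> \<le> real (card {S\<in>H. A \<subseteq> S}) * R ^ card A" using A(1) by (simp add: P_def)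
    finally have "(real (card {S\<in>H. A \<union> T \<subseteq> S}) * R ^ card T) * R ^ card A
        < real (card {S\<in>H. A \<subseteq> S}) * R ^ card A"
      by (simp add: power_add mult_ac)
    then have "real (card {S\<in>H. A \<union> T \<subseteq> S}) * R ^ card T < real (card {S\<in>H. A \<subseteq> S})"
      using R by (simp add: mult_less_cancel_right)
    then show ?thesis using R by (simp add: field_simps)
  qed simp
  with A(1) ne that show ?thesis unfolding P_def by blast
qed

section \<open>Counting supersets and degrees\<close>

text \<open>Each step multiplies by \<open>(k - a) / (n - a)\<close>, which is at most
  \<open>k / n\<close> because \<open>k \<le> n\<close>.\<close>

lemma binomial_diff_le:
  assumes "a \<le> k" "k \<le> n" "1 \<le> n"
  shows "real ((n - a) choose (k - a)) \<le> (real k / real n) ^ a * real (n choose k)"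
  using assms(1)
proof (induction a)
  case (Suc a)
  have pos: "0 < k - a" "0 < n - a" using Suc.prems assms by auto
  have "(k - a) * ((n - a) choose (k - a)) = (n - a) * ((n - Suc a) choose (k - Suc a))"
    using times_binomial_minus1_eq[OF pos(1), of "n - a"] by simp
  then have "real (k - a) * real ((n - a) choose (k - a)) = real (n - a) * real ((n - Suc a) choose (k - Suc a))"
    by (metis of_nat_mult)
  then have "real ((n - Suc a) choose (k - Suc a)) = real (k - a) / real (n - a) * real ((n - a) choose (k - a))"
    using pos by (simp add: field_simps)
  also have "\<dots> \<le> real k / real n * ((real k / real n) ^ a * real (n choose k))"
  proof (rule mult_mono)
    have "real a * real k \<le> real a * real n" using assms by (intro mult_left_mono) auto
    then show "real (k - a) / real (n - a) \<le> real k / real n"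
      using Suc.prems assms by (simp add: of_nat_diff field_simps)
  qed (use Suc in auto)
  finally show ?case by (simp add: mult_ac)
qed simp

lemma card_nsets_supset_le:
  assumes V: "finite V" "V \<noteq> {}" and A: "A \<subseteq> V"
  shows "real (card {S \<in> nsets V k. A \<subseteq> S}) \<le> (real k / real (card V)) ^ card A * real (card V choose k)"
proof (cases "card A \<le> k \<and> k \<le> card V")
  case True
  have fA: "finite A" using V A finite_subset by blast
  have "bij_betw (\<lambda>S. S - A) {S \<in> nsets V k. A \<subseteq> S} (nsets (V - A) (k - card A))"
  proof (rule bij_betwI[where g = "\<lambda>S. S \<union> A"])
    show "(\<lambda>S. S \<union> A) \<in> nsets (V - A) (k - card A) \<rightarrow> {S \<in> nsets V k. A \<subseteq> S}"
    proof
      fix S assume "S \<in> nsets (V - A) (k - card A)"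
      moreover from this have "card (S \<union> A) = card S + card A"
        using fA by (intro card_Un_disjoint) (auto simp: nsets_def)
      ultimately show "S \<union> A \<in> {S \<in> nsets V k. A \<subseteq> S}"
        using A fA True by (auto simp: nsets_def)
    qed
  qed (use fA in \<open>auto simp: nsets_def card_Diff_subset\<close>)
  then have "card {S \<in> nsets V k. A \<subseteq> S} = (card V - card A) choose (k - card A)"
    using fA A by (simp add: bij_betw_same_card card_Diff_subset)
  moreover have "1 \<le> card V" using V by (simp add: Suc_le_eq card_gt_0_iff)
  ultimately show ?thesis using binomial_diff_le[of "card A" k "card V"] True by simp
next
  case False
  have "{S \<in> nsets V k. A \<subseteq> S} = {}"
    using False V card_mono unfolding nsets_def by blast
  then show ?thesis by (simp only: card.empty) simp
qed

text \<open>Double count the pairs of an element and a member containing it.\<close>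

lemma regular_family_degree:
  assumes V: "finite V" and F: "F \<subseteq> nsets V k" and reg: "regular_family V F" and x: "x \<in> V"
  shows "card V * card {S\<in>F. x \<in> S} = k * card F"
proof -
  have finF: "finite F" using F V finite_imp_finite_nsets finite_subset by blast
  have "{y\<in>V. y \<in> S} = S" if "S \<in> F" for S using F that by (auto simp: nsets_def)
  then have "\<forall>S\<in>F. card {y\<in>V. y \<in> S} = k" using F by (auto simp: nsets_def)
  from sum_multicount[OF V finF this]
  have "(\<Sum>y\<in>V. card {S\<in>F. y \<in> S}) = k * card F" .
  moreover have "card {S\<in>F. y \<in> S} = card {S\<in>F. x \<in> S}" if "y \<in> V" for y
    using reg x that unfolding regular_family_def by blast
  then have "(\<Sum>y\<in>V. card {S\<in>F. y \<in> S}) = (\<Sum>y\<in>V. card {S\<in>F. x \<in> S})"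
    by (rule sum.cong[OF refl])
  ultimately show ?thesis by simp
qed

lemma card_meeting_le:
  assumes "finite A" "finite H" "\<And>x. x \<in> A \<Longrightarrow> real (card {S\<in>H. x \<in> S}) \<le> d"
  shows "real (card {S\<in>H. S \<inter> A \<noteq> {}}) \<le> real (card A) * d"
proof -
  have "{S\<in>H. S \<inter> A \<noteq> {}} = (\<Union>x\<in>A. {S\<in>H. x \<in> S})" by auto
  then have "card {S\<in>H. S \<inter> A \<noteq> {}} \<le> (\<Sum>x\<in>A. card {S\<in>H. x \<in> S})"
    using card_UN_le[OF assms(1), of "\<lambda>x. {S\<in>H. x \<in> S}"] by simp
  then have "real (card {S\<in>H. S \<inter> A \<noteq> {}}) \<le> real (\<Sum>x\<in>A. card {S\<in>H. x \<in> S})"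
    by (rule of_nat_mono)
  also have "\<dots> = (\<Sum>x\<in>A. real (card {S\<in>H. x \<in> S}))" by (rule of_nat_sum)
  also have "\<dots> \<le> real (card A) * d"
    by (rule sum_bounded_above) (use assms in auto)
  finally show ?thesis .
qed

section \<open>The bound for regular intersecting families\<close>

theorem theorem3:
  fixes n k q :: nat and F :: "nat set set"
  assumes "n \<ge> 1" and "k \<ge> 1" and "q \<ge> 1"
    and "real n > 2 ^ 13 * real k * log 2 (2 * real k)"
    and "n \<ge> 4 * q * k"
    and "F \<subseteq> nsets {1..n} k"
    and "regular_family {1..n} F"
    and "intersecting_family F"
  shows "real (card F) \<le> 2 powr (- real q) * real (n choose k)"
proof (cases "F = {}")
  case False
  define X where "X = {1..n}"
  have X: "finite X" "X \<noteq> {}" "card X = n" using assms(1) by (auto simp: X_def)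
  have F: "F \<subseteq> nsets X k" "regular_family X F" using assms by (auto simp: X_def)
  have finF: "finite F" using F X finite_imp_finite_nsets finite_subset by blast
  have mem: "S \<subseteq> X" "finite S" "card S = k" if "S \<in> F" for S
    using F(1) that by (auto simp: nsets_def)
  define R where "R = real n / (2 * real k)"
  \<comment> \<open>\<open>m\<close> is the number of binary digits of \<open>k\<close>:
    \<open>m\<close> rounds suffice for sets of size \<open>k\<close>, and \<open>m\<close> is at
    most \<open>log 2 (2 * k)\<close>.\<close>
  obtain m where m: "1 \<le> m" "k < 2 ^ m" "2 ^ m \<le> 2 * k"
  proof -
    obtain e where "2 ^ e \<le> k" "k < 2 ^ (e + 1)" using ex_power_ivl1[of 2 k] assms(2) by auto
    then show ?thesis by (intro that[of "e + 1"]) auto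
  qed
  have mlog: "real m \<le> log 2 (2 * real k)"
  proof -
    have "(2::real) ^ m \<le> 2 * real k" using of_nat_mono[OF m(3), where 'a = real] by simp
    then show ?thesis using assms(2) by (simp add: le_log_iff powr_realpow)
  qed
  have "2 ^ 13 * real k * real m \<le> 2 ^ 13 * real k * log 2 (2 * real k)"
    using mlog by (intro mult_left_mono) auto
  with assms(4) have "2 ^ 13 * real k * real m < real n" by linarith
  then have Rm: "2 ^ 12 * real m < R" using assms(2) by (simp add: R_def field_simps)
  then have R1: "1 \<le> R" using m(1) by simp
  then have R0: "0 < R" by simp
  have Rq: "2 * real q \<le> R"
  proof -
    have "real (4 * q * k) \<le> real n" using assms(5) by (rule of_nat_mono)
    then show ?thesis using assms(2) by (simp add: R_def field_simps)
  qed
  \<comment> \<open>Since \<open>k / n * R = 1/2\<close>, each element of a heavy \<open>A\<close>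
    contributes a factor 1/2. The exponent \<open>q + 1\<close> leaves a spare factor 2, which later
    pays for replacing \<open>F\<close> by \<open>F'\<close>.\<close>
  have small: "real (card H) \<le> (1 / 2 ^ (q + 1)) * real (n choose k)"
    if H: "H \<subseteq> F" and A: "A \<subseteq> X" "q + 1 \<le> card A"
      and heavy: "real (card H) \<le> real (card {S\<in>H. A \<subseteq> S}) * R ^ card A" for H A
  proof -
    have "card {S\<in>H. A \<subseteq> S} \<le> card {S \<in> nsets X k. A \<subseteq> S}"
      using H F(1) X(1) by (intro card_mono) (auto simp: finite_imp_finite_nsets)
    then have "real (card {S\<in>H. A \<subseteq> S}) \<le> (real k / real n) ^ card A * real (n choose k)"
      using card_nsets_supset_le[OF X(1,2) A(1), of k] X(3) by simp
    then have "real (card H) \<le> (real k / real n) ^ card A * real (n choose k) * R ^ card A"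
      using heavy R1 by (smt (verit) mult_right_mono zero_le_power)
    also have "\<dots> = (1 / 2) ^ card A * real (n choose k)"
    proof -
      have "real k / real n * R = 1 / 2" using assms(1,2) by (simp add: R_def)
      moreover have "(real k / real n) ^ card A * real (n choose k) * R ^ card A
          = (real k / real n * R) ^ card A * real (n choose k)"
        unfolding power_mult_distrib by (simp only: mult_ac)
      ultimately show ?thesis by (simp only:)
    qed
    also have "\<dots> \<le> (1 / 2) ^ (q + 1) * real (n choose k)"
      using A by (intro mult_right_mono power_decreasing) auto
    finally show ?thesis by (simp add: power_divide)
  qed
  have q2: "2 powr (- real q) = 2 * (1 / 2 ^ (q + 1))" by (simp add: powr_minus powr_realpow field_simps)
  obtain A where A: "{S\<in>F. A \<subseteq> S} \<noteq> {}" "real (card F) \<le> real (card {S\<in>F. A \<subseteq> S}) * R ^ card A"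
    "\<And>T. finite T \<Longrightarrow> T \<inter> A = {} \<Longrightarrow>
      real (card {S\<in>F. A \<union> T \<subseteq> S}) \<le> real (card {S\<in>F. A \<subseteq> S}) / R ^ card T"
    using maximal_heavy_set[OF finF \<open>F \<noteq> {}\<close> mem(2) R0] by blast
  have AX: "A \<subseteq> X" using A(1) mem(1) by blast
  have finA: "finite A" using AX X finite_subset by blast
  show ?thesis
  proof (cases "q + 1 \<le> card A")
    case True
    have "0 \<le> 1 / 2 ^ (q + 1) * real (n choose k)" by simp
    with small[OF order_refl AX True A(2)] show ?thesis unfolding q2 mult.assoc by linarith
  next
    case False
    define F' where "F' = {S\<in>F. S \<inter> A = {}}"
    have F': "F' \<subseteq> F" "finite F'" using finF by (auto simp: F'_def)
    have deg: "real (card {S\<in>F. x \<in> S}) \<le> real k * real (card F) / real n" if "x \<in> A" for x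
    proof -
      have "n * card {S\<in>F. x \<in> S} = k * card F"
        using regular_family_degree[OF X(1) F, of x] that AX X(3) by auto
      then have "real n * real (card {S\<in>F. x \<in> S}) = real k * real (card F)"
        by (metis of_nat_mult)
      then show ?thesis using assms(1) by (simp add: field_simps)
    qed
    have "real (card {S\<in>F. S \<inter> A \<noteq> {}}) \<le> real (card A) * (real k * real (card F) / real n)"
      by (rule card_meeting_le[OF finA finF deg])
    also have "\<dots> \<le> real q * (real k * real (card F) / real n)"
      using False by (intro mult_right_mono) auto
    also have "\<dots> \<le> real (card F) / 4"
    proof -
      have "real (4 * q * k) * real (card F) \<le> real n * real (card F)"
        using assms(5) by (intro mult_right_mono of_nat_mono) auto
      then show ?thesis using assms(1) by (simp add: field_simps)
    qed
    finally have meet: "real (card {S\<in>F. S \<inter> A \<noteq> {}}) \<le> real (card F) / 4" .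
    have "F = F' \<union> {S\<in>F. S \<inter> A \<noteq> {}}" by (auto simp: F'_def)
    then have "card F \<le> card F' + card {S\<in>F. S \<inter> A \<noteq> {}}" by (metis card_Un_le)
    with meet have F'large: "3 / 4 * real (card F) \<le> real (card F')" by linarith
    moreover have "0 < card F" using finF \<open>F \<noteq> {}\<close> by (simp add: card_gt_0_iff)
    ultimately have "F' \<noteq> {}" by auto
    then obtain B where B: "{S\<in>F'. B \<subseteq> S} \<noteq> {}" "real (card F') \<le> real (card {S\<in>F'. B \<subseteq> S}) * R ^ card B"
      "\<And>T. finite T \<Longrightarrow> T \<inter> B = {} \<Longrightarrow>
        real (card {S\<in>F'. B \<union> T \<subseteq> S}) \<le> real (card {S\<in>F'. B \<subseteq> S}) / R ^ card T"
      using maximal_heavy_set[OF F'(2) _ mem(2)[OF subsetD[OF F'(1)]] R0] by blast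
    have BX: "B \<subseteq> X" using B(1) mem(1) F' by blast
    have finB: "finite B" using BX X finite_subset by blast
    have BA: "B \<inter> A = {}" using B(1) by (auto simp: F'_def)
    show ?thesis
    proof (cases "q + 1 \<le> card B")
      case True
      from small[OF F'(1) BX True B(2)] F'large
      have "3 / 4 * real (card F) \<le> 1 / 2 ^ (q + 1) * real (n choose k)" by linarith
      moreover have "0 \<le> 1 / 2 ^ (q + 1) * real (n choose k)" by simp
      ultimately show ?thesis unfolding q2 mult.assoc by linarith
    next
      case smallB: False
      \<comment> \<open>Members of \<open>I\<close> avoid \<open>B\<close> and members of
        \<open>J\<close> avoid \<open>A\<close>, so two of them that are disjoint after removing
        \<open>A\<close> and \<open>B\<close> respectively are disjoint outright.\<close>
      define I where "I = {S\<in>F. A \<subseteq> S \<and> S \<inter> B = {}}"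
      define J where "J = {S\<in>F'. B \<subseteq> S}"
      define FA where "FA = {S\<in>F. A \<subseteq> S}"
      have fins: "finite I" "finite J" "finite FA" using finF F' by (auto simp: I_def J_def FA_def)
      \<comment> \<open>Elements of \<open>B\<close> lie outside \<open>A\<close>, so the maximality
        of \<open>A\<close> bounds their degrees in \<open>FA\<close>; moreover
        \<open>card B \<le> q \<le> R / 2\<close>.\<close>
      have "real (card {S\<in>FA. S \<inter> B \<noteq> {}}) \<le> real (card B) * (real (card FA) / R)"
      proof (rule card_meeting_le[OF finB fins(3)])
        fix x assume "x \<in> B"
        then have "x \<notin> A" using BA by auto
        moreover have "{S\<in>FA. x \<in> S} = {S\<in>F. A \<union> {x} \<subseteq> S}" by (auto simp: FA_def)
        ultimately show "real (card {S\<in>FA. x \<in> S}) \<le> real (card FA) / R"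
          using A(3)[of "{x}"] by (simp add: FA_def)
      qed
      also have "\<dots> \<le> R / 2 * (real (card FA) / R)"
        using smallB Rq R1 by (intro mult_right_mono) auto
      also have "\<dots> = real (card FA) / 2" using R1 by simp
      finally have meetB: "real (card {S\<in>FA. S \<inter> B \<noteq> {}}) \<le> real (card FA) / 2" .
      have "FA = I \<union> {S\<in>FA. S \<inter> B \<noteq> {}}" by (auto simp: I_def FA_def)
      then have "card FA \<le> card I + card {S\<in>FA. S \<inter> B \<noteq> {}}" by (metis card_Un_le)
      with meetB have Ilarge: "real (card FA) \<le> 2 * real (card I)" by linarith
      have "0 < card FA" using A(1) fins by (simp add: card_gt_0_iff FA_def)
      with Ilarge have "I \<noteq> {}" by auto
      have "\<exists>S\<in>I. \<exists>S'\<in>J. (S - A) \<inter> (S' - B) = {}"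
      proof (rule spread_families_disjoint_members[where \<kappa> = "R / 2"])
        show "16 * real m \<le> R / 2" using Rm by simp
        show "S - A \<subseteq> X" if "S \<in> I" for S using that mem by (auto simp: I_def)
        show "S - B \<subseteq> X" if "S \<in> J" for S using that mem F' by (auto simp: J_def)
        show "card (S - A) < 2 ^ m" if "S \<in> I" for S
          using card_mono[of S "S - A"] mem[of S] that m(2) by (auto simp: I_def)
        show "card (S - B) < 2 ^ m" if "S \<in> J" for S
          using card_mono[of S "S - B"] mem[of S] that m(2) F' by (auto simp: J_def)
        show "real (card {S\<in>I. T \<subseteq> S - A}) \<le> real (card I) / (R / 2) ^ card T" if "T \<subseteq> X" for T
        proof (cases "T = {}")
          case True
          then show ?thesis by simp
        next
          case False
          have finT: "finite T" using that X finite_subset by blast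
          show ?thesis
          proof (cases "T \<inter> A = {}")
            case True
            have "card {S\<in>I. T \<subseteq> S - A} \<le> card {S\<in>F. A \<union> T \<subseteq> S}"
              using finF by (intro card_mono) (auto simp: I_def)
            then have "real (card {S\<in>I. T \<subseteq> S - A}) \<le> real (card FA) / R ^ card T"
              using A(3)[OF finT True] unfolding FA_def by linarith
            also have "\<dots> \<le> 2 * real (card I) / R ^ card T"
              using Ilarge R1 by (intro divide_right_mono) auto
            \<comment> \<open>Passing from \<open>FA\<close> to \<open>I\<close> costs one factor 2.
              As \<open>T\<close> is nonempty, weakening \<open>R\<close> to \<open>R / 2\<close>
              absorbs it.\<close>
            also have "\<dots> \<le> 2 ^ card T * real (card I) / R ^ card T"
            proof (intro divide_right_mono mult_right_mono)
              have "1 \<le> card T" using finT False by (simp add: Suc_le_eq card_gt_0_iff)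
              then show "(2::real) \<le> 2 ^ card T" using power_increasing[of 1 "card T" "2::real"] by simp
            qed (use R1 in auto)
            also have "\<dots> = real (card I) / (R / 2) ^ card T" by (simp add: power_divide)
            finally show ?thesis .
          next
            case False
            then have "{S\<in>I. T \<subseteq> S - A} = {}" by auto
            then show ?thesis using R1 by (simp only: card.empty) simp
          qed
        qed
        show "real (card {S\<in>J. T \<subseteq> S - B}) \<le> real (card J) / (R / 2) ^ card T" if "T \<subseteq> X" for T
        proof (cases "T \<inter> B = {}")
          case True
          have finT: "finite T" using that X finite_subset by blast
          have "card {S\<in>J. T \<subseteq> S - B} \<le> card {S\<in>F'. B \<union> T \<subseteq> S}"
            using F' by (intro card_mono) (auto simp: J_def)
          then have "real (card {S\<in>J. T \<subseteq> S - B}) \<le> real (card J) / R ^ card T"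
            using B(3)[OF finT True] unfolding J_def by linarith
          also have "\<dots> \<le> real (card J) / (R / 2) ^ card T"
            using R1 by (intro divide_left_mono power_mono) auto
          finally show ?thesis .
        next
          case False
          then have "{S\<in>J. T \<subseteq> S - B} = {}" by auto
          then show ?thesis using R1 by (simp only: card.empty) simp
        qed
      qed (use X fins m \<open>I \<noteq> {}\<close> B(1) in \<open>auto simp: J_def\<close>)
      then obtain S S' where "S \<in> I" "S' \<in> J" "(S - A) \<inter> (S' - B) = {}" by blast
      then have "S \<inter> S' = {}" "S \<in> F" "S' \<in> F" by (auto simp: I_def J_def F'_def)
      with assms(8) show ?thesis by (auto simp: intersecting_family_def)
    qed
  qed
qed simp

end
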